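(* Let $m, n$ be fixed coprime natural numbers. Let $G$ be an infinite group such that $a^m b^m = b^m a^m$ and $a^n b^n = b^n a^n$ for all $a, b \in G$. (a) The set $T(G)$ of all torsion elements of $G$ is a normal abelian subgroup of $G$. (b) Any Sylow subgroup of $G$ (that is, any Sylow $p$-subgroup of $G$ for any prime $p$) is abelian; in particular, if $G$ is an infinite $p$-group for some prime $p$, then $G$ is abelian. (c) If $G$ is locally finite or residually finite, then $G$ is abelian. (d) If $G$ is residually $p$ for a prime $p$, then $G$ is abelian.
   Context: Natural numbers are positive integers. A torsion element is an element of finite order (the identity included). For a prime $p$, a $p$-group is a (possibly infinite) group in which every element has order a power of $p$, and a Sylow $p$-subgroup of a (possibly infinite) group is a maximal $p$-subgroup. For a class $\mathcal{X}$ of groups, a group $G$ is locally $\mathcal{X}$ if every finitely generated subgroup of $G$ is in $\mathcal{X}$; a group $G$ is residually $\mathcal{X}$ if for each non-identity element $g \in G$ there is a normal subgroup $N_g$ of $G$ such that $g \notin N_g$ and $G/N_g \in \mathcal{X}$. "Locally finite" and "residually finite" refer to the class of finite groups, and "residually $p$" means residually $\mathcal{X}$ where $\mathcal{X}$ is the class of all (finite or infinite) $p$-groups. *)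

theory Defs
  imports "HOL-Algebra.Algebra" "HOL-Computational_Algebra.Primes"
begin

text \<open>
  A class of groups is represented by a predicate on group records. The element order
  \<open>group.ord\<close> is \<open>0\<close> for elements of infinite order, and the groups below may be infinite.
\<close>

definition torsion_elements :: "('a, 'b) monoid_scheme \<Rightarrow> 'a set" where
  "torsion_elements G = {x \<in> carrier G. group.ord G x \<noteq> 0}"

definition finite_group :: "('a, 'b) monoid_scheme \<Rightarrow> bool" where
  "finite_group G \<longleftrightarrow> group G \<and> finite (carrier G)"

text \<open>Since \<open>p ^ k \<noteq> 0\<close> for prime \<open>p\<close>, every element of a \<open>p\<close>-group has finite order.\<close>

definition p_group :: "nat \<Rightarrow> ('a, 'b) monoid_scheme \<Rightarrow> bool" where
  "p_group p G \<longleftrightarrow> group G \<and> (\<forall>x\<in>carrier G. \<exists>k::nat. group.ord G x = p ^ k)"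

definition p_subgroup :: "nat \<Rightarrow> 'a set \<Rightarrow> ('a, 'b) monoid_scheme \<Rightarrow> bool" where
  "p_subgroup p H G \<longleftrightarrow> subgroup H G \<and> p_group p (G\<lparr>carrier := H\<rparr>)"

definition sylow_p_subgroup :: "nat \<Rightarrow> 'a set \<Rightarrow> ('a, 'b) monoid_scheme \<Rightarrow> bool" where
  "sylow_p_subgroup p P G \<longleftrightarrow>
     p_subgroup p P G \<and> (\<forall>Q. p_subgroup p Q G \<and> P \<subseteq> Q \<longrightarrow> Q = P)"

definition locally_class ::
    "(('a, 'b) monoid_scheme \<Rightarrow> bool) \<Rightarrow> ('a, 'b) monoid_scheme \<Rightarrow> bool" where
  "locally_class C G \<longleftrightarrow>
     (\<forall>S. finite S \<and> S \<subseteq> carrier G \<longrightarrow> C (G\<lparr>carrier := generate G S\<rparr>))"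

text \<open>Here the class predicate is applied to quotients, whose elements are cosets of type
  \<open>'a set\<close>.\<close>

definition residually_class ::
    "('a set monoid \<Rightarrow> bool) \<Rightarrow> ('a, 'b) monoid_scheme \<Rightarrow> bool" where
  "residually_class C G \<longleftrightarrow>
     (\<forall>g\<in>carrier G. g \<noteq> \<one>\<^bsub>G\<^esub> \<longrightarrow> (\<exists>N. N \<lhd> G \<and> g \<notin> N \<and> C (G Mod N)))"

end

theory Submission
  imports Defs
begin

text \<open>
  The hypotheses already force \<open>G\<close> to be abelian. A commutator \<open>c = [a, b]\<close> of an \<open>m\<close>-th power
  \<open>a\<close> and an \<open>n\<close>-th power \<open>b\<close> is a product of two \<open>m\<close>-th powers, and also a product of two
  \<open>n\<close>-th powers, so it commutes with \<open>a\<close> and \<open>b\<close>. Hence \<open>c\<^sup>m = [a, b\<^sup>m]\<close> and \<open>c\<^sup>n = [a\<^sup>n, b]\<close>, both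
  trivial as commutators of two \<open>m\<close>-th, respectively two \<open>n\<close>-th, powers; thus \<open>c = \<one>\<close> by
  coprimality. So \<open>m\<close>-th powers commute with \<open>n\<close>-th powers, and every element is a product of an
  \<open>m\<close>-th power and an \<open>n\<close>-th power.
\<close>

text \<open>By Bezout an element is a quotient of a power of its \<open>m\<close>-th power by a
  power of its \<open>n\<close>-th power, so these two powers determine it.\<close>

lemma (in group) eq_if_coprime_pow_eq:
  fixes m n :: nat
  assumes x: "x \<in> carrier G" and y: "y \<in> carrier G" and "coprime m n"
    and m: "x [^] m = y [^] m" and n: "x [^] n = y [^] n"
  shows "x = y"
proof (cases "m = 0")
  case True
  \<comment> \<open>Coprimality with \<open>m = 0\<close> forces \<open>n = 1\<close>, so the second
    power equation is already the claim.\<close>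
  then show ?thesis using assms by simp
next
  case False
  then obtain s t where st: "m * s = n * t + 1"
    using bezout_nat[of m n] \<open>coprime m n\<close> by auto
  have ms: "x [^] (m * s) = y [^] (m * s)"
    using x y m by (simp flip: nat_pow_pow)
  have nt: "x [^] (n * t) = y [^] (n * t)"
    using x y n by (simp flip: nat_pow_pow)
  from ms have "x [^] (n * t) \<otimes> x = y [^] (n * t) \<otimes> y"
    by (simp add: st)
  then show ?thesis
    using x y nt by simp
qed

lemma (in group) conj_eq_iff_commute:
  assumes "a \<in> carrier G" "b \<in> carrier G"
  shows "a \<otimes> b \<otimes> inv a = b \<longleftrightarrow> a \<otimes> b = b \<otimes> a"
  using assms by (metis inv_solve_right' m_closed)

lemma (in group) conj_nat_pow:
  fixes k :: nat
  assumes "a \<in> carrier G" "b \<in> carrier G"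
  shows "(a \<otimes> b \<otimes> inv a) [^] k = a \<otimes> b [^] k \<otimes> inv a"
proof (induction k)
  case 0
  then show ?case using assms by simp
next
  case (Suc k)
  have "inv a \<otimes> (a \<otimes> (b \<otimes> inv a)) = b \<otimes> inv a"
    using assms by (simp flip: m_assoc)
  then have "(a \<otimes> b [^] k \<otimes> inv a) \<otimes> (a \<otimes> b \<otimes> inv a) = a \<otimes> (b [^] k \<otimes> b) \<otimes> inv a"
    using assms by (simp add: m_assoc)
  then show ?case using Suc by simp
qed

text \<open>Conjugation by \<open>g\<close> fixes both powers of \<open>x\<close>, so
  \<open>x\<close> and its conjugate share their \<open>m\<close>-th and \<open>n\<close>-th powers
  and coincide.\<close>

lemma (in group) commute_if_coprime_pow_commute:
  fixes m n :: nat
  assumes g: "g \<in> carrier G" and x: "x \<in> carrier G" and "coprime m n"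
    and "g \<otimes> x [^] m = x [^] m \<otimes> g" and "g \<otimes> x [^] n = x [^] n \<otimes> g"
  shows "g \<otimes> x = x \<otimes> g"
proof -
  have "g \<otimes> x \<otimes> inv g = x"
    by (rule eq_if_coprime_pow_eq[OF _ x \<open>coprime m n\<close>])
      (use assms in \<open>simp_all add: conj_nat_pow, simp_all add: m_assoc\<close>)
  then show ?thesis using g x by (simp add: conj_eq_iff_commute)
qed

text \<open>A conjugate of an \<open>n\<close>-th power is an \<open>n\<close>-th power, so the
  conjugate of \<open>v [^] n\<close> by \<open>a\<close> commutes with \<open>v [^] n\<close>.
  Hence the exponent \<open>m\<close> distributes over the commutator, and by \<open>comm\<close>
  the two factors cancel.\<close>

lemma (in group) commutator_pow_eq_one:
  fixes m n :: nat
  assumes a: "a \<in> carrier G" and v: "v \<in> carrier G"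
    and n: "\<And>x y. x \<in> carrier G \<Longrightarrow> y \<in> carrier G \<Longrightarrow> x [^] n \<otimes> y [^] n = y [^] n \<otimes> x [^] n"
    and comm: "a \<otimes> (v [^] n) [^] m = (v [^] n) [^] m \<otimes> a"
  shows "(a \<otimes> v [^] n \<otimes> inv a \<otimes> inv (v [^] n)) [^] m = \<one>"
proof -
  define b where "b = v [^] n"
  define d where "d = a \<otimes> b \<otimes> inv a"
  have [simp]: "b \<in> carrier G" "d \<in> carrier G"
    using a v by (simp_all add: b_def d_def)
  have "d = (a \<otimes> v \<otimes> inv a) [^] n"
    using a v by (simp add: b_def d_def conj_nat_pow)
  then have "d \<otimes> b = b \<otimes> d"
    using n[of "a \<otimes> v \<otimes> inv a" v] a v by (simp add: b_def)
  then have "d \<otimes> inv b = inv b \<otimes> d"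
    by (metis \<open>b \<in> carrier G\<close> \<open>d \<in> carrier G\<close> inv_closed inv_solve_left inv_solve_right' m_assoc m_closed)
  then have "(d \<otimes> inv b) [^] m = d [^] m \<otimes> inv (b [^] m)"
    by (subst pow_mult_distrib) (simp_all add: nat_pow_inv)
  also have "d [^] m = b [^] m"
    using a v comm by (simp add: d_def b_def conj_nat_pow, simp add: m_assoc)
  finally show ?thesis
    by (simp add: d_def b_def[symmetric])
qed

lemma (in group) comm_group_if_coprime_pow_commute:
  fixes m n :: nat
  assumes mn: "coprime m n"
    and m: "\<And>x y. x \<in> carrier G \<Longrightarrow> y \<in> carrier G \<Longrightarrow> x [^] m \<otimes> y [^] m = y [^] m \<otimes> x [^] m"
    and n: "\<And>x y. x \<in> carrier G \<Longrightarrow> y \<in> carrier G \<Longrightarrow> x [^] n \<otimes> y [^] n = y [^] n \<otimes> x [^] n"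
  shows "comm_group G"
proof -
  have mn_comm: "u [^] m \<otimes> v [^] n = v [^] n \<otimes> u [^] m"
    if u: "u \<in> carrier G" and v: "v \<in> carrier G" for u v
  proof -
    define a where "a = u [^] m"
    define b where "b = v [^] n"
    define c where "c = a \<otimes> b \<otimes> inv a \<otimes> inv b"
    have [simp]: "a \<in> carrier G" "b \<in> carrier G" "c \<in> carrier G"
      using u v by (simp_all add: a_def b_def c_def)
    have pow_swap: "(x [^] i) [^] j = (x [^] j) [^] i" if "x \<in> carrier G" for x and i j :: nat
      using that by (simp add: nat_pow_pow mult.commute)
    have "c [^] m = \<one>"
      unfolding c_def b_def
      by (rule commutator_pow_eq_one) (use u v m[of u b] n in \<open>auto simp: a_def b_def\<close>)
    \<comment> \<open>The same lemma with \<open>a\<close>, \<open>b\<close> and \<open>m\<close>,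
      \<open>n\<close> exchanged; its premise \<open>comm\<close> holds since \<open>b\<close> and
      \<open>a [^] n\<close> are both \<open>n\<close>-th powers.\<close>
    moreover have "(b \<otimes> a \<otimes> inv b \<otimes> inv a) [^] n = \<one>"
      unfolding a_def
      by (rule commutator_pow_eq_one) (use u v n[of v a] m in \<open>auto simp: a_def b_def\<close>)
    moreover have "b \<otimes> a \<otimes> inv b \<otimes> inv a = inv c"
      by (simp add: c_def inv_mult_group m_assoc)
    ultimately have "c [^] m = \<one>" "c [^] n = \<one>"
      by (simp_all add: nat_pow_inv)
    then have "c = \<one>"
      using eq_if_coprime_pow_eq[OF _ _ mn, of c \<one>] by simp
    then have "a \<otimes> b \<otimes> inv a = b"
      by (simp add: c_def inv_solve_right')
    then show ?thesis
      by (simp add: conj_eq_iff_commute flip: a_def b_def)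
  qed
  show ?thesis
  proof (rule group_comm_groupI)
    fix x y assume x: "x \<in> carrier G" and y: "y \<in> carrier G"
    \<comment> \<open>Exponents are removed one side at a time: each of \<open>x [^] m\<close> and
      \<open>x [^] n\<close> commutes with \<open>y [^] m\<close> and \<open>y [^] n\<close>, hence
      with \<open>y\<close>; then \<open>y\<close> commutes with \<open>x\<close>.\<close>
    have "x [^] m \<otimes> y = y \<otimes> x [^] m"
      by (rule commute_if_coprime_pow_commute[OF _ _ mn]) (use x y m mn_comm in simp_all)
    moreover have "x [^] n \<otimes> y = y \<otimes> x [^] n"
      by (rule commute_if_coprime_pow_commute[OF _ _ mn]) (use x y n mn_comm in simp_all)
    ultimately have "y \<otimes> x = x \<otimes> y"
      by (intro commute_if_coprime_pow_commute[OF y x mn]) simp_all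
    then show "x \<otimes> y = y \<otimes> x" ..
  qed
qed

lemma (in comm_group) comm_group_subgroup:
  assumes "subgroup H G"
  shows "comm_group (G\<lparr>carrier := H\<rparr>)"
proof -
  interpret H: group "G\<lparr>carrier := H\<rparr>"
    using assms by (rule subgroup_imp_group)
  show ?thesis
    by (rule H.group_comm_groupI) (use assms in \<open>auto intro: m_comm dest: subgroup.mem_carrier\<close>)
qed

lemma (in group) mem_torsion_elements_iff:
  "x \<in> torsion_elements G \<longleftrightarrow> x \<in> carrier G \<and> (\<exists>k::nat. k > 0 \<and> x [^] k = \<one>)"
  using ord_eq_0 by (auto simp: torsion_elements_def simp del: neq0_conv simp flip: neq0_conv)

lemma (in comm_group) subgroup_torsion_elements: "subgroup (torsion_elements G) G"
proof (rule subgroupI)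
  show "torsion_elements G \<subseteq> carrier G"
    by (auto simp: torsion_elements_def)
  have "\<one> \<in> torsion_elements G"
    by (auto simp: mem_torsion_elements_iff)
  then show "torsion_elements G \<noteq> {}" by blast
next
  fix a assume "a \<in> torsion_elements G"
  then show "inv a \<in> torsion_elements G"
    by (auto simp: mem_torsion_elements_iff nat_pow_inv)
next
  fix a b assume "a \<in> torsion_elements G" "b \<in> torsion_elements G"
  then obtain k l :: nat where a: "a \<in> carrier G" "k > 0" "a [^] k = \<one>"
    and b: "b \<in> carrier G" "l > 0" "b [^] l = \<one>"
    by (auto simp: mem_torsion_elements_iff)
  \<comment> \<open>A common exponent for both factors; commutativity lets it kill the product as
    well.\<close>
  have "a [^] (k * l) = \<one>" "b [^] (k * l) = \<one>"
    using a b by (simp flip: nat_pow_pow, simp add: mult.commute[of k] flip: nat_pow_pow)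
  then have "(a \<otimes> b) [^] (k * l) = \<one>"
    using a b by (simp add: pow_mult_distrib m_comm)
  moreover have "k * l > 0"
    using a b by simp
  ultimately show "a \<otimes> b \<in> torsion_elements G"
    using a b unfolding mem_torsion_elements_iff by blast
qed

theorem theorem4p1:
  fixes G :: "('a, 'b) monoid_scheme" (structure)
    and m n :: nat
  assumes "m > 0" and "n > 0" and "coprime m n"
    and "group G" and "infinite (carrier G)"
    and "\<And>a b. a \<in> carrier G \<Longrightarrow> b \<in> carrier G \<Longrightarrow> a [^] m \<otimes> b [^] m = b [^] m \<otimes> a [^] m"
    and "\<And>a b. a \<in> carrier G \<Longrightarrow> b \<in> carrier G \<Longrightarrow> a [^] n \<otimes> b [^] n = b [^] n \<otimes> a [^] n"
  shows "(torsion_elements G \<lhd> G \<and> comm_group (G\<lparr>carrier := torsion_elements G\<rparr>))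
    \<and> ((\<forall>p P. Factorial_Ring.prime p \<and> sylow_p_subgroup p P G \<longrightarrow> comm_group (G\<lparr>carrier := P\<rparr>))
        \<and> (\<forall>p. Factorial_Ring.prime p \<and> p_group p G \<longrightarrow> comm_group G))
    \<and> (locally_class finite_group G \<or> residually_class finite_group G \<longrightarrow> comm_group G)
    \<and> (\<forall>p. Factorial_Ring.prime p \<and> residually_class (p_group p) G \<longrightarrow> comm_group G)"
proof -
  \<comment> \<open>This settles every part: the torsion elements and the Sylow subgroups form
    subgroups of an abelian group, and the other conclusions are \<open>comm_group G\<close>
    itself.\<close>
  have "comm_group G"
    using group.comm_group_if_coprime_pow_commute[OF \<open>group G\<close> \<open>coprime m n\<close>] assms(6,7) by blast
  then interpret comm_group G .
  have "torsion_elements G \<lhd> G"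
    by (rule subgroup_imp_normal[OF subgroup_torsion_elements])
  moreover have "comm_group (G\<lparr>carrier := torsion_elements G\<rparr>)"
    by (rule comm_group_subgroup[OF subgroup_torsion_elements])
  moreover have "comm_group (G\<lparr>carrier := P\<rparr>)" if "sylow_p_subgroup p P G" for p P
    using that comm_group_subgroup by (simp add: sylow_p_subgroup_def p_subgroup_def)
  ultimately show ?thesis
    using \<open>comm_group G\<close> by blast
qed

end
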